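(* Let $d\ge 1$ be a fixed integer and $q$ a fixed prime power. For $n\ge 1$, choose $a_0(x),\ldots,a_{n-1}(x)\in\mathbb{F}_q[x]$ independently and uniformly at random from the set of polynomials of degree at most $d$, and let $$f(x,y)=y^n+a_{n-1}(x)y^{n-1}+\cdots+a_1(x)y+a_0(x)\in\mathbb{F}_q[x][y].$$ Then $$\lim_{n\to\infty}\mathbb{P}(f\text{ is irreducible})=1-\frac{1}{q^d}.$$
   Context: Irreducibility of $f$ is as a polynomial in $y$ over $\mathbb{F}_q(x)$ (equivalently, since $f$ is monic in $y$, in $\mathbb{F}_q[x,y]$). *)

theory Defs
  imports
    "HOL-Probability.Probability"
    "HOL-Computational_Algebra.Computational_Algebra"
begin

definition polys_deg_le :: "nat \<Rightarrow> 'a::{field,finite} poly set" where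
  "polys_deg_le d = {p. degree p \<le> d}"

lemma zero_in_polys_deg_le: "0 \<in> polys_deg_le d"
  by (simp add: polys_deg_le_def)

text \<open>
  The library's \<^const>\<open>pmf_of_set\<close> is meaningful only for finite nonempty sets.
\<close>

lemma finite_polys_deg_le: "finite (polys_deg_le d :: 'a::{field,finite} poly set)"
proof (rule finite_subset)
  show "(polys_deg_le d :: 'a poly set) \<subseteq> Poly ` {xs. set xs \<subseteq> UNIV \<and> length xs \<le> Suc d}"
  proof
    fix p :: "'a poly" assume "p \<in> polys_deg_le d"
    then have "length (coeffs p) \<le> Suc d"
      by (cases "p = 0") (auto simp: polys_deg_le_def length_coeffs_degree)
    then show "p \<in> Poly ` {xs. set xs \<subseteq> UNIV \<and> length xs \<le> Suc d}"
      by (intro image_eqI[of _ _ "coeffs p"]) auto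
  qed
  show "finite (Poly ` {xs :: 'a list. set xs \<subseteq> UNIV \<and> length xs \<le> Suc d})"
    by (intro finite_imageI finite_lists_length_le) simp
qed

text \<open>
  Coefficient families are functions on all of \<^typ>\<open>nat\<close>; those in the support of
  this distribution vanish outside \<open>{..<n}\<close>.
\<close>

definition random_coeffs :: "nat \<Rightarrow> nat \<Rightarrow> (nat \<Rightarrow> 'a::{field,finite} poly) pmf" where
  "random_coeffs d n = Pi_pmf {..<n} 0 (\<lambda>_. pmf_of_set (polys_deg_le d))"

text \<open>
  In \<^typ>\<open>'a poly poly\<close> the outer variable is \<open>y\<close> and the inner one is \<open>x\<close>.
\<close>

definition monic_with_coeffs :: "nat \<Rightarrow> (nat \<Rightarrow> 'a::field poly) \<Rightarrow> 'a poly poly" where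
  "monic_with_coeffs n a = monom 1 n + (\<Sum>i<n. monom (a i) i)"

definition irreducible_over_rational_functions :: "'a::field poly poly \<Rightarrow> bool" where
  "irreducible_over_rational_functions f \<longleftrightarrow> irreducible (map_poly to_fract f)"

end

theory Submission
  imports Defs
begin

text \<open>
  Read as a polynomial in \<open>x\<close>, \<open>f\<close> has \<open>d + 1\<close> coefficients in \<open>F\<^sub>q[y]\<close>, one of them monic
  of degree \<open>n\<close> and the others arbitrary of degree \<open>< n\<close>. Splitting off their monic gcd gives
  \<open>q\<^bsup>(d+1)n\<^esup> = (\<Sum>k\<le>n. q\<^bsup>k\<^esup> N(n - k))\<close>, where \<open>N(m)\<close> counts the coprime families; hence the
  coefficients are coprime with probability exactly \<open>1 - q\<^bsup>-d\<^esup>\<close> for every \<open>n \<ge> 1\<close>.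

  An irreducible \<open>f\<close> with non-coprime coefficients lies in \<open>F\<^sub>q[y]\<close>, which allows only \<open>q\<^bsup>n\<^esup>\<close>
  polynomials. By Gauss's lemma a reducible \<open>f\<close> with coprime coefficients is a product of two monic
  factors, both of positive degree in \<open>x\<close> and hence both of \<open>x\<close>-degree at most \<open>d - 1\<close>, which
  allows at most \<open>n q\<^bsup>dn\<^esup>\<close> products. Both counts are negligible against \<open>q\<^bsup>(d+1)n\<^esup>\<close>.
\<close>

section \<open>Polynomials in two variables\<close>

text \<open>The embedding of F[y] into F[x][y]. Since the outer variable is y, it acts on
  coefficients, turning scalars into constants in x.\<close>

definition lift_y :: "'a::comm_ring_1 poly \<Rightarrow> 'a poly poly" where
  "lift_y g = map_poly (\<lambda>c. [:c:]) g"

text \<open>The coefficient of x^j when \<open>f\<close> is read in F[y][x]; together with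
  \<open>lift_y\<close> it allows this second reading without exchanging the variables.\<close>

definition x_coeff :: "nat \<Rightarrow> 'a::comm_ring_1 poly poly \<Rightarrow> 'a poly" where
  "x_coeff j f = map_poly (\<lambda>c. coeff c j) f"

lemma coeff_lift_y [simp]: "coeff (lift_y g) m = [:coeff g m:]"
  by (simp add: lift_y_def coeff_map_poly)

lemma coeff_x_coeff [simp]: "coeff (x_coeff j f) m = coeff (coeff f m) j"
  by (simp add: x_coeff_def coeff_map_poly)

lemma lift_y_0 [simp]: "lift_y 0 = 0"
  by (simp add: lift_y_def)

lemma lift_y_eq_iff [simp]: "lift_y g = lift_y h \<longleftrightarrow> g = h"
  by (simp add: poly_eq_iff[of "lift_y g"] poly_eq_iff[of g])

lemma lift_y_eq_0_iff [simp]: "lift_y g = 0 \<longleftrightarrow> g = 0"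
  using lift_y_eq_iff[of g 0] by (simp del: lift_y_eq_iff)

lemma degree_lift_y [simp]: "degree (lift_y g) = degree g"
  unfolding lift_y_def by (rule degree_map_poly) simp

lemma pCons_0_sum: "[:sum f A:] = (\<Sum>i\<in>A. [:f i:])"
  by (rule poly_eqI) (simp add: coeff_sum coeff_pCons split: nat.split)

lemma lift_y_mult: "lift_y (g * h) = lift_y g * lift_y h"
  by (rule poly_eqI) (simp add: coeff_mult pCons_0_sum mult.commute)

lemma x_coeff_lift_y_mult: "x_coeff j (lift_y g * f) = g * x_coeff j f"
  by (rule poly_eqI) (simp add: coeff_mult coeff_sum)

lemma x_degree_bound_exists: "\<exists>D. \<forall>m. degree (coeff f m) \<le> D"
proof -
  have "finite (range (coeff f))"
    by (simp add: range_coeff)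
  then show ?thesis
    by (intro exI[of _ "Max (degree ` range (coeff f))"]) (auto intro!: Max_ge)
qed

lemma x_degree_le_iff:
  "(\<forall>m. degree (coeff f m) \<le> D) \<longleftrightarrow> (\<forall>j>D. x_coeff j f = 0)"
proof
  assume "\<forall>m. degree (coeff f m) \<le> D"
  then show "\<forall>j>D. x_coeff j f = 0"
    by (metis coeff_0 coeff_eq_0 coeff_x_coeff le_less_trans poly_eqI)
next
  assume *: "\<forall>j>D. x_coeff j f = 0"
  have "coeff (coeff f m) j = 0" if "j > D" for m j
    using * that by (metis coeff_0 coeff_x_coeff)
  then show "\<forall>m. degree (coeff f m) \<le> D"
    by (auto intro: degree_le)
qed

text \<open>An element of F[y] is a scalar when \<open>f\<close> is expanded in powers of x, so
  divisibility by it can be tested on each x-coefficient.\<close>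

lemma lift_y_dvd_iff: "lift_y g dvd f \<longleftrightarrow> (\<forall>j. g dvd x_coeff j f)"
proof
  assume "lift_y g dvd f"
  then show "\<forall>j. g dvd x_coeff j f"
    by (auto simp: x_coeff_lift_y_mult elim!: dvdE)
next
  assume *: "\<forall>j. g dvd x_coeff j f"
  obtain D where D: "\<And>m. degree (coeff f m) \<le> D"
    using x_degree_bound_exists by blast
  \<comment> \<open>\<open>[:monom 1 j:]\<close> is x^j, seen as a constant in y.\<close>
  have "f = (\<Sum>j\<le>D. [:monom 1 j:] * lift_y (x_coeff j f))"
  proof (rule poly_eqI)
    fix m
    have "coeff f m = (\<Sum>j\<le>D. monom (coeff (coeff f m) j) j)"
      by (rule poly_as_sum_of_monoms'[symmetric]) (rule D)
    then show "coeff f m = coeff (\<Sum>j\<le>D. [:monom 1 j:] * lift_y (x_coeff j f)) m"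
      by (simp add: coeff_sum smult_monom)
  qed
  moreover have "lift_y g dvd (\<Sum>j\<le>D. [:monom 1 j:] * lift_y (x_coeff j f))"
    using * by (intro dvd_sum dvd_mult) (metis dvd_def lift_y_mult)
  ultimately show "lift_y g dvd f"
    by simp
qed

text \<open>For bounds that are not both attained, both sides vanish. This lets one pair of bounds
  serve all y-coefficients in the next lemma.\<close>

lemma coeff_mult_degree_bounds:
  assumes "degree p \<le> i" and "degree q \<le> j"
  shows "coeff (p * q) (i + j) = coeff p i * coeff q j"
proof (cases "degree p = i \<and> degree q = j")
  case True
  then show ?thesis
    using coeff_mult_degree_sum by blast
next
  case False
  then have "degree p < i \<or> degree q < j"
    using assms by auto
  moreover have "degree (p * q) < i + j"
    using False assms degree_mult_le[of p q] by linarith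
  ultimately show ?thesis
    by (auto simp: coeff_eq_0)
qed

lemma x_coeff_mult_top:
  assumes "\<forall>m. degree (coeff g m) \<le> i" and "\<forall>m. degree (coeff h m) \<le> j"
  shows "x_coeff (i + j) (g * h) = x_coeff i g * x_coeff j h"
  using assms
  by (intro poly_eqI) (simp add: coeff_mult[of g h] coeff_mult[of "x_coeff i g"] coeff_sum coeff_mult_degree_bounds)

lemma x_degree_exists:
  assumes "f \<noteq> 0"
  obtains i where "\<forall>m. degree (coeff f m) \<le> i" and "x_coeff i f \<noteq> 0"
proof -
  define i where "i = (LEAST D. \<forall>m. degree (coeff f m) \<le> D)"
  have i: "\<forall>m. degree (coeff f m) \<le> i"
    unfolding i_def using x_degree_bound_exists by (rule LeastI_ex)
  have "x_coeff i f \<noteq> 0"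
  proof
    assume 0: "x_coeff i f = 0"
    \<comment> \<open>If the coefficient at the least bound \<open>i\<close> vanished, then either
      \<open>i = 0\<close> and \<open>f = 0\<close>, or \<open>i - 1\<close> would be a smaller
      bound.\<close>
    show False
    proof (cases i)
      case 0
      then have "\<forall>j. x_coeff j f = 0"
        using i \<open>x_coeff i f = 0\<close> x_degree_le_iff[of f i] by (metis neq0_conv)
      then have "f = 0"
        by (metis coeff_0 coeff_x_coeff poly_eqI)
      with assms show False by simp
    next
      case (Suc k)
      have "\<forall>j>k. x_coeff j f = 0"
        using i 0 Suc x_degree_le_iff[of f i] by (metis Suc_lessI)
      then have "\<forall>m. degree (coeff f m) \<le> k"
        by (simp only: x_degree_le_iff)
      then have "i \<le> k"
        unfolding i_def by (rule Least_le)
      with Suc show False by simp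
    qed
  qed
  with i that show ?thesis by blast
qed

lemma x_degree_0_imp_lift_y:
  assumes "\<forall>m. degree (coeff f m) \<le> 0"
  shows "f = lift_y (x_coeff 0 f)"
proof (rule poly_eqI)
  fix m
  show "coeff f m = coeff (lift_y (x_coeff 0 f)) m"
    using assms degree_0_id[of "coeff f m"] by simp
qed

text \<open>Irreducible polynomials over a field are prime, and a reducible one has a proper
  nonconstant factor of smaller degree. The cancellation arguments below peel off such primes one at
  a time.\<close>

lemma exists_prime_elem_dvd_poly:
  fixes p :: "'a::field poly"
  assumes "degree p > 0"
  shows "\<exists>r. prime_elem r \<and> degree r > 0 \<and> r dvd p"
  using assms
proof (induction "degree p" arbitrary: p rule: less_induct)
  case less
  have p: "p \<noteq> 0" "\<not> is_unit p"
    using less.prems by (force, metis degree_0 is_unit_iff_degree less_irrefl)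
  show ?case
  proof (cases "irreducible p")
    case True
    then show ?thesis
      using less.prems field_poly_irreducible_imp_prime[of p] by (intro exI[of _ p]) simp
  next
    case False
    then obtain a b where ab: "p = a * b" "\<not> is_unit a" "\<not> is_unit b"
      using p unfolding irreducible_def by blast
    have "a \<noteq> 0" "b \<noteq> 0"
      using p(1) unfolding ab(1) by simp_all
    moreover from this have "0 < degree a" "0 < degree b"
      using ab(2,3) by (simp_all add: is_unit_iff_degree)
    ultimately have "0 < degree a" "degree a < degree p"
      unfolding ab(1) by (simp_all add: degree_mult_eq)
    then obtain r where "prime_elem r" "degree r > 0" "r dvd a"
      using less.hyps by blast
    then show ?thesis
      using ab by auto
  qed
qed

section \<open>Primitivity in \<open>y\<close>\<close>

text \<open>
  Equivalently, the coefficients of \<open>f\<close> as a polynomial in \<open>x\<close> are coprime. Divisibility is used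
  instead of a gcd because the polynomials over an arbitrary field are not an instance of the
  library's gcd classes.
\<close>

definition y_primitive :: "'a::comm_ring_1 poly poly \<Rightarrow> bool" where
  "y_primitive f \<longleftrightarrow> (\<forall>g. lift_y g dvd f \<longrightarrow> degree g = 0)"

text \<open>Used in both directions, this makes the F[y]-part of a polynomial unique. A prime
  \<open>r\<close> dividing \<open>g\<close> divides every \<open>g' * x_coeff j h'\<close> but, by
  primitivity, not every \<open>x_coeff j h'\<close>; so it divides \<open>g'\<close> and can be
  cancelled.\<close>

lemma lift_y_factor_dvd:
  fixes g g' :: "'a::field poly"
  assumes "lift_y g * h = lift_y g' * h'" and "y_primitive h'" and "g \<noteq> 0"
  shows "g dvd g'"
  using assms(1,3)
proof (induction "degree g" arbitrary: g g' rule: less_induct)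
  case less
  show ?case
  proof (cases "degree g = 0")
    case True
    then show ?thesis
      using less.prems by (auto simp: is_unit_iff_degree intro: unit_imp_dvd)
  next
    case False
    then obtain r where r: "prime_elem r" "degree r > 0" "r dvd g"
      using exists_prime_elem_dvd_poly by blast
    then obtain k where k: "g = r * k"
      by blast
    have "r dvd g' * x_coeff j h'" for j
      using arg_cong[OF less.prems(1), of "x_coeff j"] r(3)
      by (metis dvd_mult2 x_coeff_lift_y_mult)
    moreover have "\<not> (\<forall>j. r dvd x_coeff j h')"
      using assms(2) r(2) by (auto simp: y_primitive_def lift_y_dvd_iff[symmetric])
    ultimately have "r dvd g'"
      using r(1) prime_elem_dvd_multD by blast
    then obtain k' where k': "g' = r * k'"
      by blast
    have "r \<noteq> 0" "k \<noteq> 0"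
      using k less.prems by auto
    then have "lift_y k * h = lift_y k' * h'"
      using less.prems(1) by (simp add: k k' lift_y_mult mult.assoc)
    moreover have "degree k < degree g"
      using k \<open>r \<noteq> 0\<close> \<open>k \<noteq> 0\<close> r(2) by (simp add: degree_mult_eq)
    ultimately have "k dvd k'"
      using less.hyps \<open>k \<noteq> 0\<close> by blast
    then show ?thesis
      by (simp add: k k')
  qed
qed

lemma monic_dvd_antisym:
  fixes g g' :: "'a::field poly"
  assumes "g dvd g'" "g' dvd g" "lead_coeff g = 1" "lead_coeff g' = 1"
  shows "g = g'"
proof -
  obtain k where k: "g' = g * k" using assms(1) by blast
  have "degree g' = degree g"
    using assms by (metis dvd_imp_degree_le le_antisym leading_coeff_0_iff zero_neq_one)
  then have "degree k = 0"
    using k assms by (metis add_cancel_left_right degree_mult_eq leading_coeff_0_iff mult_eq_0_iff zero_neq_one)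
  moreover have "lead_coeff k = 1"
    using k assms by (simp add: lead_coeff_mult)
  ultimately have "k = 1"
    by (metis degree_0_id one_pCons)
  with k show ?thesis by simp
qed

text \<open>Take a divisor from F[y] of maximal degree, bounded by \<open>degree f\<close>; a
  nonconstant divisor left in the cofactor would raise that degree.\<close>

lemma y_primitive_decomposition:
  fixes f :: "'a::field poly poly"
  assumes "f \<noteq> 0"
  obtains g h where "f = lift_y g * h" and "lead_coeff g = 1" and "y_primitive h"
proof -
  define P where "P k \<longleftrightarrow> (\<exists>g. lift_y g dvd f \<and> degree g = k)" for k
  have deg: "degree g \<le> degree f" if "lift_y g dvd f" for g
    using dvd_imp_degree_le[OF that assms] by simp
  have "lift_y 1 dvd f"
    by (simp add: lift_y_def)
  then have "P 0"
    unfolding P_def by (intro exI[of _ 1]) simp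
  define K where "K = Greatest P"
  have "P K"
    unfolding K_def using \<open>P 0\<close> deg by (intro GreatestI_nat[of P 0 "degree f"]) (auto simp: P_def)
  then obtain g0 where g0: "lift_y g0 dvd f" "degree g0 = K"
    by (auto simp: P_def)
  have "g0 \<noteq> 0"
    using g0(1) assms by auto
  define c where "c = lead_coeff g0"
  have c: "c \<noteq> 0" using \<open>g0 \<noteq> 0\<close> by (simp add: c_def)
  \<comment> \<open>Scaling by a constant makes the divisor monic and keeps both its degree and its
    divisibility.\<close>
  define g where "g = smult (inverse c) g0"
  have "g0 = [:c:] * g" "g = [:inverse c:] * g0"
    using c by (simp_all add: g_def)
  then have "lift_y g dvd lift_y g0"
    by (metis dvd_triv_right lift_y_mult)
  then have "lift_y g dvd f" "degree g = K" "lead_coeff g = 1"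
    using g0 c by (auto simp: g_def c_def intro: dvd_trans)
  then obtain h where h: "f = lift_y g * h"
    by blast
  have "y_primitive h"
    unfolding y_primitive_def
  proof (intro allI impI)
    fix g2 assume g2: "lift_y g2 dvd h"
    then have "lift_y (g * g2) dvd f"
      by (simp add: h lift_y_mult)
    then have "degree (g * g2) \<le> K"
      unfolding K_def using deg by (intro Greatest_le_nat[of P _ "degree f"]) (auto simp: P_def)
    moreover have "g \<noteq> 0" "g2 \<noteq> 0"
      using g2 h assms by auto
    ultimately show "degree g2 = 0"
      using \<open>degree g = K\<close> by (simp add: degree_mult_eq)
  qed
  with h \<open>lead_coeff g = 1\<close> that show ?thesis by blast
qed

section \<open>Gauss's lemma for monic polynomials\<close>

lemma fract_poly_clear_denominators:
  fixes G :: "'a::idom fract poly"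
  shows "\<exists>c g. c \<noteq> 0 \<and> smult (to_fract c) G = map_poly to_fract g"
proof (induction G)
  case 0
  show ?case by (intro exI[of _ 1] exI[of _ 0]) simp
next
  case (pCons x G)
  obtain c g where cg: "c \<noteq> 0" "smult (to_fract c) G = map_poly to_fract g"
    using pCons.IH by blast
  obtain a b where ab: "x = Fract a b" "b \<noteq> 0"
    by (cases x)
  have "smult (to_fract (b * c)) (pCons x G) = map_poly to_fract (pCons (a * c) (smult b g))"
    using ab cg(2) by (simp add: map_poly_pCons Fract_conv_to_fract flip: smult_smult)
  then show ?case
    using ab cg by (metis mult_eq_0_iff)
qed

text \<open>The core of Gauss's lemma: a prime \<open>r\<close> dividing \<open>c\<close> stays
  prime as the constant \<open>[:r:]\<close>, so it divides \<open>g\<close> or \<open>h\<close> and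
  cancels there without changing degrees in y.\<close>

lemma smult_factorization_imp_factorization:
  fixes f :: "'a::field poly poly"
  assumes "smult c f = g * h" and "c \<noteq> 0"
  shows "\<exists>g' h'. f = g' * h' \<and> degree g' = degree g \<and> degree h' = degree h"
  using assms
proof (induction "degree c" arbitrary: c g h rule: less_induct)
  case less
  show ?case
  proof (cases "degree c = 0")
    \<comment> \<open>Here \<open>c\<close> is a unit, whose inverse is absorbed into
      \<open>g\<close>.\<close>
    case True
    then have "is_unit c"
      using less.prems by (simp add: is_unit_iff_degree)
    then obtain c' where c': "c' * c = 1"
      by (metis dvdE mult.commute)
    then have "f = smult c' (smult c f)"
      by simp
    also have "\<dots> = smult c' g * h"
      by (simp add: less.prems)
    finally show ?thesis
      using c' by (metis degree_smult_eq mult_zero_left zero_neq_one)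
  next
    case False
    then obtain r where r: "prime_elem r" "degree r > 0" "r dvd c"
      using exists_prime_elem_dvd_poly by blast
    then obtain k where k: "c = r * k"
      by blast
    have nz: "r \<noteq> 0" "k \<noteq> 0"
      using k less.prems by auto
    have less': "degree k < degree c"
      using k nz r(2) by (simp add: degree_mult_eq)
    have eq: "g * h = [:r:] * ([:k:] * f)"
      using less.prems(1) k by (simp add: mult.commute)
    then have "[:r:] dvd g \<or> [:r:] dvd h"
      using lift_prime_elem_poly[OF r(1)] by (metis dvd_triv_left prime_elem_dvd_mult_iff)
    then show ?thesis
    proof
      assume "[:r:] dvd g"
      then obtain g1 where g1: "g = smult r g1" by (auto elim!: dvdE)
      have "smult k f = g1 * h"
        using eq nz(1) mult_left_cancel[of "[:r:]" "[:k:] * f" "g1 * h"]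
        by (simp add: g1)
      from less.hyps[OF less' this nz(2)] show ?thesis
        using g1 nz by simp
    next
      assume "[:r:] dvd h"
      then obtain h1 where h1: "h = smult r h1" by (auto elim!: dvdE)
      have "smult k f = g * h1"
        using eq nz(1) mult_left_cancel[of "[:r:]" "[:k:] * f" "g * h1"]
        by (simp add: h1)
      from less.hyps[OF less' this nz(2)] show ?thesis
        using h1 nz by simp
    qed
  qed
qed

lemma degree_fract_poly [simp]: "degree (map_poly to_fract f) = degree f"
  by (rule degree_map_poly) simp

text \<open>Clear the denominators of both factors, remove the resulting scalar by the previous
  lemma, then normalize the leading coefficients.\<close>

lemma monic_reducible_over_fract_imp_factorization:
  fixes f :: "'a::field poly poly"
  assumes "lead_coeff f = 1" and "degree f > 0" and "\<not> irreducible (map_poly to_fract f)"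
  obtains g h where "f = g * h" "lead_coeff g = 1" "lead_coeff h = 1" "degree g > 0" "degree h > 0"
proof -
  let ?F = "map_poly to_fract f"
  have "f \<noteq> 0" using assms by auto
  then have "?F \<noteq> 0" "\<not> is_unit ?F"
    using assms by (simp_all add: is_unit_iff_degree)
  then obtain G H where GH: "?F = G * H" "\<not> is_unit G" "\<not> is_unit H"
    using assms(3) by (auto simp: irreducible_def)
  then have "G \<noteq> 0" "H \<noteq> 0"
    using \<open>?F \<noteq> 0\<close> by auto
  then have deg: "degree G > 0" "degree H > 0"
    using GH by (auto simp: is_unit_iff_degree)
  obtain a g where a: "a \<noteq> 0" "smult (to_fract a) G = map_poly to_fract g"
    using fract_poly_clear_denominators by blast
  obtain b h where b: "b \<noteq> 0" "smult (to_fract b) H = map_poly to_fract h"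
    using fract_poly_clear_denominators by blast
  have dg: "degree g = degree G"
    using arg_cong[OF a(2), of degree] a(1) by simp
  have dh: "degree h = degree H"
    using arg_cong[OF b(2), of degree] b(1) by simp
  have "map_poly to_fract (smult (a * b) f) = smult (to_fract a) G * smult (to_fract b) H"
    using GH(1) by (simp add: mult.commute)
  also have "\<dots> = map_poly to_fract (g * h)"
    by (simp add: a(2) b(2))
  finally have "smult (a * b) f = g * h"
    by (simp only: fract_poly_eq_iff)
  then obtain g' h' where gh: "f = g' * h'" "degree g' = degree g" "degree h' = degree h"
    using smult_factorization_imp_factorization[of "a * b" f g h] a(1) b(1) by auto
  \<comment> \<open>As \<open>f\<close> is monic, \<open>u * v = 1\<close>; scaling
    \<open>g'\<close> by \<open>v\<close> and \<open>h'\<close> by \<open>u\<close> makes both monic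
    and preserves the product.\<close>
  define u where "u = lead_coeff g'"
  define v where "v = lead_coeff h'"
  have uv: "u * v = 1"
    using assms(1) gh(1) by (simp add: u_def v_def lead_coeff_mult)
  then have "u \<noteq> 0" "v \<noteq> 0" by auto
  show ?thesis
  proof (rule that[of "smult v g'" "smult u h'"])
    show "f = smult v g' * smult u h'"
      using gh(1) uv by (simp add: mult.commute)
    show "lead_coeff (smult v g') = 1" "lead_coeff (smult u h') = 1"
      using uv by (simp_all only: lead_coeff_smult flip: u_def v_def) (simp_all add: mult.commute)
    show "degree (smult v g') > 0" "degree (smult u h') > 0"
      using \<open>u \<noteq> 0\<close> \<open>v \<noteq> 0\<close> gh dg dh deg by simp_all
  qed
qed

section \<open>Counting\<close>

text \<open>The range of the random polynomial for \<open>D = d\<close>; \<open>D = 0\<close> gives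
  the monic polynomials of degree \<open>n\<close> in F[y], and \<open>D = d - 1\<close> will hold
  the factors of reducible primitive ones.\<close>

definition bimonic :: "nat \<Rightarrow> nat \<Rightarrow> 'a::comm_ring_1 poly poly set" where
  "bimonic D n = {f. degree f = n \<and> lead_coeff f = 1 \<and> (\<forall>m. degree (coeff f m) \<le> D)}"

lemma card_polys_deg_le: "card (polys_deg_le d :: 'a::{field,finite} poly set) = CARD('a) ^ Suc d"
proof (induction d)
  case 0
  have "bij_betw (\<lambda>c. [:c:]) (UNIV :: 'a set) (polys_deg_le 0)"
    by (rule bij_betwI'[where X = UNIV]) (auto simp: polys_deg_le_def elim: degree_eq_zeroE)
  then show ?case
    using bij_betw_same_card by fastforce
next
  case (Suc d)
  have "bij_betw (\<lambda>(c, p). pCons c p) (UNIV \<times> polys_deg_le d :: ('a \<times> 'a poly) set) (polys_deg_le (Suc d))"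
  proof (rule bij_betwI', safe)
    fix p :: "'a poly" assume "p \<in> polys_deg_le (Suc d)"
    then show "\<exists>x\<in>UNIV \<times> polys_deg_le d. p = (case x of (c, p) \<Rightarrow> pCons c p)"
      by (cases p) (auto simp: polys_deg_le_def degree_pCons_eq_if split: if_splits)
  qed (auto simp: polys_deg_le_def degree_pCons_eq_if)
  from bij_betw_same_card[OF this] show ?case
    using Suc by (simp add: card_cartesian_product)
qed

lemma coeff_monic_with_coeffs:
  "coeff (monic_with_coeffs n a) m = (if m = n then 1 else if m < n then a m else 0)"
  by (auto simp: monic_with_coeffs_def coeff_sum)

text \<open>The default value 0 outside \<open>{..<n}\<close> makes the coefficient family
  recoverable from the polynomial.\<close>

lemma bij_betw_monic_with_coeffs:
  "bij_betw (monic_with_coeffs n) (PiE_dflt {..<n} 0 (\<lambda>_. polys_deg_le D))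
     (bimonic D n :: 'a::{field,finite} poly poly set)"
proof (rule bij_betwI')
  fix a b :: "nat \<Rightarrow> 'a poly"
  assume ab: "a \<in> PiE_dflt {..<n} 0 (\<lambda>_. polys_deg_le D)" "b \<in> PiE_dflt {..<n} 0 (\<lambda>_. polys_deg_le D)"
  show "monic_with_coeffs n a = monic_with_coeffs n b \<longleftrightarrow> a = b"
  proof
    assume eq: "monic_with_coeffs n a = monic_with_coeffs n b"
    show "a = b"
    proof
      fix m
      show "a m = b m"
        using ab arg_cong[OF eq, of "\<lambda>f. coeff f m"]
        by (cases "m < n") (auto simp: coeff_monic_with_coeffs PiE_dflt_def)
    qed
  qed simp
next
  fix a :: "nat \<Rightarrow> 'a poly"
  assume a: "a \<in> PiE_dflt {..<n} 0 (\<lambda>_. polys_deg_le D)"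
  have "degree (monic_with_coeffs n a) = n"
    by (intro antisym degree_le le_degree) (auto simp: coeff_monic_with_coeffs)
  then show "monic_with_coeffs n a \<in> bimonic D n"
    using a by (auto simp: bimonic_def coeff_monic_with_coeffs PiE_dflt_def polys_deg_le_def)
next
  fix f :: "'a poly poly"
  assume f: "f \<in> bimonic D n"
  have "f = monic_with_coeffs n (\<lambda>m. if m < n then coeff f m else 0)"
    using f by (intro poly_eqI) (simp add: coeff_monic_with_coeffs bimonic_def coeff_eq_0, auto)
  then show "\<exists>a\<in>PiE_dflt {..<n} 0 (\<lambda>_. polys_deg_le D). f = monic_with_coeffs n a"
    using f by (intro bexI) (auto simp: PiE_dflt_def polys_deg_le_def bimonic_def)
qed

lemma finite_bimonic [simp]: "finite (bimonic D n :: 'a::{field,finite} poly poly set)"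
  using bij_betw_finite[OF bij_betw_monic_with_coeffs[of n D]]
  by (auto intro!: finite_PiE_dflt finite_polys_deg_le)

lemma card_bimonic:
  "card (bimonic D n :: 'a::{field,finite} poly poly set) = CARD('a) ^ (Suc D * n)"
  using bij_betw_same_card[OF bij_betw_monic_with_coeffs[of n D, where 'a = 'a]]
  by (simp only: card_PiE_dflt finite_polys_deg_le card_polys_deg_le finite_lessThan prod_constant
      card_lessThan power_mult)

text \<open>The bijection carries the uniform distribution on coefficient families to the uniform
  one on \<open>bimonic d n\<close>, so probabilities become counts.\<close>

lemma prob_random_coeffs:
  "measure_pmf.prob (random_coeffs d n :: (nat \<Rightarrow> 'a::{field,finite} poly) pmf)
     {a. P (monic_with_coeffs n a)} = real (card {f \<in> bimonic d n. P f}) / real (CARD('a) ^ (Suc d * n))"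
proof -
  let ?A = "PiE_dflt {..<n} 0 (\<lambda>_. polys_deg_le d) :: (nat \<Rightarrow> 'a poly) set"
  have ne: "(polys_deg_le d :: 'a poly set) \<noteq> {}"
    using zero_in_polys_deg_le by blast
  have "random_coeffs d n = pmf_of_set ?A"
    unfolding random_coeffs_def using ne by (intro Pi_pmf_of_set) (auto simp: finite_polys_deg_le)
  moreover have "map_pmf (monic_with_coeffs n) (pmf_of_set ?A) = pmf_of_set (bimonic d n)"
    using ne
    by (intro map_pmf_of_set_bij_betw bij_betw_monic_with_coeffs)
       (auto intro!: finite_PiE_dflt finite_polys_deg_le)
  ultimately have *: "map_pmf (monic_with_coeffs n) (random_coeffs d n) = pmf_of_set (bimonic d n :: 'a poly poly set)"
    by simp
  have "card (bimonic d n :: 'a poly poly set) \<noteq> 0"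
    by (simp add: card_bimonic)
  then have "(bimonic d n :: 'a poly poly set) \<noteq> {}"
    by auto
  then have "measure_pmf.prob (pmf_of_set (bimonic d n :: 'a poly poly set)) {f. P f}
      = real (card (bimonic d n \<inter> {f. P f})) / real (card (bimonic d n :: 'a poly poly set))"
    by (intro measure_pmf_of_set) auto
  then show ?thesis
    by (simp add: card_bimonic Int_def vimage_def flip: *)
qed

section \<open>Splitting off monic factors in F[y] and counting primitive polynomials\<close>

lemma bimonic_0_imp_lift_y:
  assumes "f \<in> bimonic 0 n"
  shows "\<exists>g. f = lift_y g \<and> lead_coeff g = 1 \<and> degree g = n"
proof -
  have "f = lift_y (x_coeff 0 f)"
    using assms by (intro x_degree_0_imp_lift_y) (simp add: bimonic_def)
  then obtain g where g: "f = lift_y g" by blast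
  with assms show ?thesis
    by (auto simp: bimonic_def one_pCons)
qed

text \<open>Multiplying by a nonzero element of F[y] kills no nonzero x-coefficient, so the bound on
  the degree in x is unaffected; only the degree in y shifts.\<close>

lemma lift_y_mult_in_bimonic_iff:
  fixes g :: "'a::field poly"
  assumes "lead_coeff g = 1"
  shows "lift_y g * h \<in> bimonic D n \<longleftrightarrow> degree g \<le> n \<and> h \<in> bimonic D (n - degree g)"
proof (cases "h = 0")
  case True
  then show ?thesis by (auto simp: bimonic_def)
next
  case False
  have "g \<noteq> 0" using assms by auto
  then have "degree (lift_y g * h) = degree g + degree h"
    using False by (simp add: degree_mult_eq)
  moreover have "lead_coeff (lift_y g * h) = lead_coeff h"
    using assms by (simp only: lead_coeff_mult) (simp add: flip: one_pCons)
  moreover have "(\<forall>m. degree (coeff (lift_y g * h) m) \<le> D) \<longleftrightarrow> (\<forall>m. degree (coeff h m) \<le> D)"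
    using \<open>g \<noteq> 0\<close> by (simp add: x_degree_le_iff x_coeff_lift_y_mult)
  ultimately show ?thesis
    by (auto simp: bimonic_def)
qed

lemma card_bimonic_eq_sum_primitive:
  "card (bimonic d n :: 'a::{field,finite} poly poly set) =
     (\<Sum>k\<le>n. CARD('a) ^ k * card {h \<in> bimonic d (n - k) :: 'a poly poly set. y_primitive h})"
proof -
  let ?P = "\<lambda>m. {h \<in> bimonic d m :: 'a poly poly set. y_primitive h}"
  \<comment> \<open>A triple records the degree \<open>k\<close> of the F[y]-part, that part itself
    (one of q^k elements of \<open>bimonic 0 k\<close>), and the primitive cofactor.\<close>
  let ?S = "Sigma {..n} (\<lambda>k. (bimonic 0 k :: 'a poly poly set) \<times> ?P (n - k))"
  have "bij_betw (\<lambda>(k, G, h). G * h) ?S (bimonic d n)"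
  proof (rule bij_betwI')
    fix x y assume x: "x \<in> ?S" and y: "y \<in> ?S"
    obtain k G h where x': "x = (k, G, h)" by (cases x)
    obtain k' G' h' where y': "y = (k', G', h')" by (cases y)
    have xs: "G \<in> bimonic 0 k" "h \<in> bimonic d (n - k)" "y_primitive h" using x x' by auto
    have ys: "G' \<in> bimonic 0 k'" "h' \<in> bimonic d (n - k')" "y_primitive h'" using y y' by auto
    obtain g where g: "G = lift_y g" "lead_coeff g = 1" "degree g = k"
      using bimonic_0_imp_lift_y[OF xs(1)] by blast
    obtain g' where g': "G' = lift_y g'" "lead_coeff g' = 1" "degree g' = k'"
      using bimonic_0_imp_lift_y[OF ys(1)] by blast
    have "g \<noteq> 0" "g' \<noteq> 0" using g g' by auto
    show "(case x of (k, G, h) \<Rightarrow> G * h) = (case y of (k, G, h) \<Rightarrow> G * h) \<longleftrightarrow> x = y"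
    proof
      assume "(case x of (k, G, h) \<Rightarrow> G * h) = (case y of (k, G, h) \<Rightarrow> G * h)"
      then have eq: "lift_y g * h = lift_y g' * h'"
        by (simp add: x' y' g g')
      have "g dvd g'" "g' dvd g"
        using lift_y_factor_dvd[OF eq ys(3)] lift_y_factor_dvd[OF eq[symmetric] xs(3)]
          \<open>g \<noteq> 0\<close> \<open>g' \<noteq> 0\<close> by auto
      then have "g = g'"
        using g g' monic_dvd_antisym by blast
      moreover from this have "h = h'"
        using eq \<open>g \<noteq> 0\<close> by simp
      ultimately show "x = y"
        using x' y' g g' by simp
    qed simp
  next
    fix x assume x: "x \<in> ?S"
    obtain k G h where x': "x = (k, G, h)" by (cases x)
    have xs: "k \<le> n" "G \<in> bimonic 0 k" "h \<in> bimonic d (n - k)" using x x' by auto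
    obtain g where g: "G = lift_y g" "lead_coeff g = 1" "degree g = k"
      using bimonic_0_imp_lift_y[OF xs(2)] by blast
    show "(case x of (k, G, h) \<Rightarrow> G * h) \<in> bimonic d n"
      using xs g by (simp add: x' lift_y_mult_in_bimonic_iff)
  next
    fix f :: "'a poly poly" assume f: "f \<in> bimonic d n"
    then have "f \<noteq> 0" by (auto simp: bimonic_def)
    then obtain g h where gh: "f = lift_y g * h" "lead_coeff g = 1" "y_primitive h"
      by (rule y_primitive_decomposition)
    then have "degree g \<le> n" "h \<in> bimonic d (n - degree g)"
      using f by (auto simp: lift_y_mult_in_bimonic_iff)
    moreover have "lift_y g \<in> bimonic 0 (degree g)"
      using gh(2) by (simp add: bimonic_def one_pCons)
    ultimately show "\<exists>x\<in>?S. f = (case x of (k, G, h) \<Rightarrow> G * h)"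
      using gh by (intro bexI[of _ "(degree g, lift_y g, h)"]) auto
  qed
  from bij_betw_same_card[OF this] show ?thesis
    by (simp add: card_SigmaI card_cartesian_product card_bimonic)
qed

text \<open>In the sum for \<open>Suc n\<close>, the terms with \<open>k > 0\<close> add up to q
  times the sum for \<open>n\<close>, which leaves the single term \<open>k = 0\<close>. Stated
  additively, it avoids subtraction on naturals.\<close>

lemma card_y_primitive_Suc:
  "card {h \<in> bimonic d (Suc n) :: 'a::{field,finite} poly poly set. y_primitive h}
     + CARD('a) * CARD('a) ^ (Suc d * n) = CARD('a) ^ (Suc d * Suc n)"
proof -
  let ?P = "\<lambda>m. card {h \<in> bimonic d m :: 'a poly poly set. y_primitive h}"
  have "CARD('a) ^ (Suc d * Suc n) = (\<Sum>k\<le>Suc n. CARD('a) ^ k * ?P (Suc n - k))"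
    by (simp only: card_bimonic_eq_sum_primitive flip: card_bimonic)
  also have "\<dots> = ?P (Suc n) + (\<Sum>k\<le>n. CARD('a) ^ Suc k * ?P (n - k))"
    by (subst sum.atMost_Suc_shift) simp
  also have "(\<Sum>k\<le>n. CARD('a) ^ Suc k * ?P (n - k)) = CARD('a) * (\<Sum>k\<le>n. CARD('a) ^ k * ?P (n - k))"
    by (simp add: sum_distrib_left mult.assoc)
  also have "(\<Sum>k\<le>n. CARD('a) ^ k * ?P (n - k)) = CARD('a) ^ (Suc d * n)"
    by (simp only: card_bimonic_eq_sum_primitive flip: card_bimonic)
  finally show ?thesis by simp
qed

section \<open>Irreducibility and primitivity\<close>

text \<open>A nonconstant divisor from F[y] is a nonunit over F(x), so irreducibility makes its
  cofactor constant in y.\<close>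

lemma irreducible_not_primitive_imp_bimonic_0:
  fixes f :: "'a::field poly poly"
  assumes "f \<in> bimonic d n" and "irreducible_over_rational_functions f" and "\<not> y_primitive f"
  shows "f \<in> bimonic 0 n"
proof -
  obtain g h where gh: "f = lift_y g * h" "degree g > 0"
    using assms(3) by (auto simp: y_primitive_def elim!: dvdE)
  have "f \<noteq> 0" using assms by (auto simp: bimonic_def)
  then have "g \<noteq> 0" "h \<noteq> 0" using gh by auto
  have "map_poly to_fract f = map_poly to_fract (lift_y g) * map_poly to_fract h"
    by (simp add: gh)
  moreover have "\<not> is_unit (map_poly to_fract (lift_y g))"
    using gh \<open>g \<noteq> 0\<close> by (simp add: is_unit_iff_degree)
  ultimately have "is_unit (map_poly to_fract h)"
    using assms(2) irreducibleD unfolding irreducible_over_rational_functions_def by blast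
  then have "degree h = 0"
    using \<open>h \<noteq> 0\<close> by (simp add: is_unit_iff_degree)
  then obtain c where c: "h = [:c:]" by (rule degree_eq_zeroE)
  \<comment> \<open>Comparing leading coefficients with the monic \<open>f\<close> makes
    \<open>c\<close> a unit of F[x], hence constant in x too.\<close>
  have "[:lead_coeff g:] * c = 1"
    using assms(1) lead_coeff_mult[of "lift_y g" h] c unfolding bimonic_def gh(1)[symmetric] by simp
  then have "degree c = 0"
    by (metis dvd_triv_right is_unit_iff_degree not_is_unit_0)
  then obtain e where "c = [:e:]" by (rule degree_eq_zeroE)
  then have "\<forall>m. degree (coeff f m) \<le> 0"
    by (simp add: gh(1) c)
  then show ?thesis
    using assms(1) by (auto simp: bimonic_def)
qed

text \<open>The degrees in x of the two monic factors sum to at most \<open>d\<close>, and neither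
  is 0, since such a factor would lie in F[y] and contradict primitivity. Hence each is at most
  \<open>d - 1\<close>.\<close>

lemma primitive_reducible_imp_product:
  fixes f :: "'a::field poly poly"
  assumes f: "f \<in> bimonic d n" and prim: "y_primitive f" and "n > 0"
    and red: "\<not> irreducible_over_rational_functions f"
  shows "\<exists>k\<in>{1..n}. f \<in> (\<lambda>(g, h). g * h) ` (bimonic (d - 1) k \<times> bimonic (d - 1) (n - k))"
proof -
  have "lead_coeff f = 1" "degree f = n"
    using f by (auto simp: bimonic_def)
  then obtain g h where gh: "f = g * h" "lead_coeff g = 1" "lead_coeff h = 1" "degree g > 0" "degree h > 0"
    using monic_reducible_over_fract_imp_factorization[of f] red \<open>n > 0\<close>
    unfolding irreducible_over_rational_functions_def by blast
  have "g \<noteq> 0" "h \<noteq> 0" using gh by auto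
  obtain i where i: "\<forall>m. degree (coeff g m) \<le> i" "x_coeff i g \<noteq> 0"
    using x_degree_exists[OF \<open>g \<noteq> 0\<close>] by blast
  obtain j where j: "\<forall>m. degree (coeff h m) \<le> j" "x_coeff j h \<noteq> 0"
    using x_degree_exists[OF \<open>h \<noteq> 0\<close>] by blast
  have not_lift: "i' \<noteq> 0" if "\<forall>m. degree (coeff g' m) \<le> i'" "g' dvd f" "degree g' > 0" for g' i'
  proof
    assume "i' = 0"
    with that(1) have "g' = lift_y (x_coeff 0 g')"
      by (intro x_degree_0_imp_lift_y) simp
    then show False
      using that prim unfolding y_primitive_def by (metis degree_lift_y less_numeral_extra(3))
  qed
  have "i \<noteq> 0" "j \<noteq> 0"
    using not_lift[OF i(1)] not_lift[OF j(1)] gh by auto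
  moreover have "i + j \<le> d"
  proof (rule ccontr)
    assume "\<not> i + j \<le> d"
    then have "x_coeff (i + j) f = 0"
      using f x_degree_le_iff[of f d] by (simp add: bimonic_def)
    then show False
      using x_coeff_mult_top[OF i(1) j(1)] i(2) j(2) gh(1) by simp
  qed
  ultimately have "i \<le> d - 1" "j \<le> d - 1"
    by auto
  then have "g \<in> bimonic (d - 1) (degree g)" "h \<in> bimonic (d - 1) (degree h)"
    using i(1) j(1) gh by (auto simp: bimonic_def intro: order_trans)
  moreover have "degree g + degree h = n"
    using \<open>degree f = n\<close> gh(1) \<open>g \<noteq> 0\<close> \<open>h \<noteq> 0\<close> by (simp add: degree_mult_eq)
  ultimately have "f \<in> (\<lambda>(g, h). g * h) ` (bimonic (d - 1) (degree g) \<times> bimonic (d - 1) (n - degree g))"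
    using gh(1) by (intro image_eqI[of _ _ "(g, h)"]) auto
  moreover have "degree g \<in> {1..n}"
    using gh \<open>degree g + degree h = n\<close> by auto
  ultimately show ?thesis by blast
qed

text \<open>Each set is covered by the other plus a small exceptional set:
  \<open>bimonic 0 n\<close> in one direction, products of two factors of smaller degree in x in the
  other.\<close>

lemma card_irreducible_minus_card_primitive:
  fixes d n :: nat
  assumes "d \<ge> 1" and "n > 0"
  defines "irr \<equiv> {f \<in> bimonic d n :: 'a::{field,finite} poly poly set. irreducible_over_rational_functions f}"
    and "prm \<equiv> {f \<in> bimonic d n :: 'a poly poly set. y_primitive f}"
  shows "\<bar>real (card irr) - real (card prm)\<bar> \<le> real n * real (CARD('a) ^ (d * n))"
proof -
  let ?q = "CARD('a)"
  let ?U = "\<Union>k\<in>{1..n}. (\<lambda>(g, h). g * h) ` (bimonic (d - 1) k \<times> bimonic (d - 1) (n - k)) :: 'a poly poly set"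
  have fin: "finite irr" "finite prm"
    by (simp_all add: irr_def prm_def)
  have "irr \<subseteq> prm \<union> bimonic 0 n"
    using irreducible_not_primitive_imp_bimonic_0 by (auto simp: irr_def prm_def)
  then have "card irr \<le> card (prm \<union> bimonic 0 n)"
    by (intro card_mono) (auto simp: fin)
  also have "\<dots> \<le> card prm + card (bimonic 0 n :: 'a poly poly set)"
    by (rule card_Un_le)
  also have "card (bimonic 0 n :: 'a poly poly set) = ?q ^ (1 * n)"
    by (simp add: card_bimonic)
  also have "\<dots> \<le> ?q ^ (d * n)"
    using assms by (intro power_increasing mult_le_mono1) (auto simp: Suc_le_eq)
  also have "\<dots> \<le> n * ?q ^ (d * n)"
    using assms by simp
  finally have 1: "card irr \<le> card prm + n * ?q ^ (d * n)"
    by simp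
  \<comment> \<open>With degree in x at most \<open>d - 1\<close>, the factors allow q^(dk) and
    q^(d(n-k)) choices, a product independent of \<open>k\<close>; the \<open>n\<close> values of
    \<open>k\<close> give the factor \<open>n\<close>.\<close>
  have "card ((\<lambda>(g, h). g * h) ` (bimonic (d - 1) k \<times> bimonic (d - 1) (n - k)) :: 'a poly poly set) \<le> ?q ^ (d * n)"
    if "k \<in> {1..n}" for k
  proof -
    have "card ((\<lambda>(g, h). g * h) ` (bimonic (d - 1) k \<times> bimonic (d - 1) (n - k)) :: 'a poly poly set)
      \<le> card (bimonic (d - 1) k \<times> bimonic (d - 1) (n - k) :: ('a poly poly \<times> 'a poly poly) set)"
      by (rule card_image_le) simp
    also have "\<dots> = ?q ^ (d * k + d * (n - k))"
      using assms(1) by (simp add: card_cartesian_product card_bimonic power_add)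
    also have "d * k + d * (n - k) = d * n"
      using that by (simp flip: add_mult_distrib2)
    finally show ?thesis .
  qed
  then have "card ?U \<le> n * ?q ^ (d * n)"
    using card_UN_le[of "{1..n}" "\<lambda>k. (\<lambda>(g, h). g * h) ` (bimonic (d - 1) k \<times> bimonic (d - 1) (n - k)) :: 'a poly poly set"]
      sum_bounded_above[of "{1..n}" "\<lambda>k. card ((\<lambda>(g, h). g * h) ` (bimonic (d - 1) k \<times> bimonic (d - 1) (n - k)) :: 'a poly poly set)" "?q ^ (d * n)"]
    by auto
  moreover have "prm \<subseteq> irr \<union> ?U"
    using primitive_reducible_imp_product[OF _ _ \<open>n > 0\<close>] by (fastforce simp: irr_def prm_def)
  then have "card prm \<le> card (irr \<union> ?U)"
    by (intro card_mono) (auto simp: fin)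
  then have "card prm \<le> card irr + card ?U"
    using card_Un_le order_trans by blast
  ultimately have 2: "card prm \<le> card irr + n * ?q ^ (d * n)"
    by linarith
  from 1 2 have "real (card irr) \<le> real (card prm + n * ?q ^ (d * n))"
    "real (card prm) \<le> real (card irr + n * ?q ^ (d * n))"
    by (simp_all only: of_nat_le_iff)
  then show ?thesis
    unfolding of_nat_add of_nat_mult by linarith
qed

section \<open>Passage to the limit\<close>

theorem theorem1p2:
  fixes d q :: nat
  assumes "d \<ge> 1"
    and "q = CARD('a::{field,finite})"
  shows "(\<lambda>n. measure_pmf.prob (random_coeffs d n :: (nat \<Rightarrow> 'a poly) pmf)
              {a. irreducible_over_rational_functions (monic_with_coeffs n a)})
         \<longlonglongrightarrow> 1 - 1 / real q ^ d"
proof -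
  let ?p = "\<lambda>n. measure_pmf.prob (random_coeffs d n :: (nat \<Rightarrow> 'a poly) pmf)
              {a. irreducible_over_rational_functions (monic_with_coeffs n a)}"
  have "card {0, 1 :: 'a} \<le> q"
    unfolding assms(2) by (rule card_mono) auto
  then have q: "q \<ge> 2" by simp
  \<comment> \<open>The error n q^(dn) divided by the total q^((d+1)n).\<close>
  have bound: "norm (?p n - (1 - 1 / real q ^ d)) \<le> real n * (1 / real q) ^ n" if n: "n > 0" for n
  proof -
    \<comment> \<open>For positive \<open>n\<close> the exact count applies and gives primitivity
      probability 1 - 1/q^d, with no error term.\<close>
    obtain m where m: "n = Suc m" using n gr0_implies_Suc by blast
    let ?irr = "real (card {f \<in> bimonic d n :: 'a poly poly set. irreducible_over_rational_functions f})"
    let ?prm = "real (card {f \<in> bimonic d n :: 'a poly poly set. y_primitive f})"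
    let ?T = "real q ^ (Suc d * n)"
    have T: "?T > 0" using q by simp
    have "?prm + real q * real q ^ (Suc d * m) = ?T"
      using arg_cong[OF card_y_primitive_Suc[where 'a = 'a, of d m], of real]
      unfolding m assms(2) of_nat_add of_nat_mult of_nat_power .
    moreover have "real q * real q ^ (Suc d * m) = ?T / real q ^ d"
      using q by (simp add: m power_add field_simps)
    ultimately have "?prm = ?T * (1 - 1 / real q ^ d)"
      by (simp add: right_diff_distrib)
    then have "?p n - (1 - 1 / real q ^ d) = (?irr - ?prm) / ?T"
      using T by (simp add: prob_random_coeffs flip: assms(2)) (simp add: field_simps)
    then have "norm (?p n - (1 - 1 / real q ^ d)) = \<bar>?irr - ?prm\<bar> / ?T"
      using T by simp
    also have "\<dots> \<le> real n * real (q ^ (d * n)) / ?T"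
      using card_irreducible_minus_card_primitive[OF assms(1) n, where 'a = 'a] T
      unfolding assms(2) by (intro divide_right_mono) auto
    also have "\<dots> = real n * (1 / real q) ^ n"
      using q by (simp add: power_add power_one_over field_simps)
    finally show ?thesis .
  qed
  \<comment> \<open>Since \<open>q \<ge> 2\<close>, the ratio 1/q is below 1 and geometric decay
    beats the linear factor.\<close>
  have "(\<lambda>n. real n * (1 / real q) ^ n) \<longlonglongrightarrow> 0"
    using q by (intro powser_times_n_limit_0) auto
  moreover have "eventually (\<lambda>n. norm (?p n - (1 - 1 / real q ^ d)) \<le> real n * (1 / real q) ^ n) sequentially"
    using bound by (auto intro: eventually_sequentiallyI[of 1])
  ultimately have "(\<lambda>n. ?p n - (1 - 1 / real q ^ d)) \<longlonglongrightarrow> 0"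
    by (rule Lim_null_comparison[rotated])
  then show ?thesis
    by (rule LIM_zero_cancel)
qed

end
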